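(* Let $T$ be a tree of order $n\ge 4$ such that its complement $\overline{T}$ is connected. Then $$2|\mathrm{leaf}(T)|+2|\mathrm{leaf}(\overline{T})|\le \gamma_{tc}(M(T))+\gamma_{tc}(M(\overline{T}))\le \frac{n^2+3n-8}{2}.$$
   Context: All graphs are finite, simple and undirected; $\overline{T}$ is the complement of $T$, and $\mathrm{leaf}(H)=\{v\in V(H)\mid \deg_H(v)=1\}$. For a graph $H$, a set $D\subseteq V(H)$ is a total dominating set if every vertex of $H$ has a neighbor in $D$. A set $D\subseteq V(H)$ is a total outer-connected dominating set of $H$ if $D$ is a total dominating set and the induced subgraph $H[V(H)\setminus D]$ is connected; $\gamma_{tc}(H)$ denotes the minimum cardinality of a total outer-connected dominating set of $H$. The middle graph $M(G)$ of a graph $G$ has vertex set $V(G)\cup E(G)$, where two elements $x,y$ are adjacent iff either $x,y\in E(G)$ are edges of $G$ sharing an endpoint, or one of them is a vertex of $G$ and the other is an edge of $G$ incident to it. *)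

theory Defs
  imports "Graph_Theory.Graph_Theory"
begin

text \<open>Finite simple undirected graphs are the \<^locale>\<open>pair_graph\<close>s of the library: an edge \<open>uv\<close>
  is the pair of arcs \<open>(u, v)\<close>, \<open>(v, u)\<close>. The degree of \<open>v\<close> is therefore its out-degree.\<close>

text \<open>The library's \<^const>\<open>tree\<close> is not usable here: in a symmetric digraph the walk \<open>u, v, u\<close> is a
  \<^const>\<open>pre_digraph.cycle\<close>. The cycles of a simple graph are those of length at least 3.\<close>

definition graph_tree :: "'a pair_pre_digraph \<Rightarrow> bool" where
  "graph_tree G \<longleftrightarrow> pair_graph G \<and> connected (with_proj G) \<and>
     \<not> (\<exists>p. pre_digraph.cycle (with_proj G) p \<and> 3 \<le> length p)"

definition graph_complement :: "'a pair_pre_digraph \<Rightarrow> 'a pair_pre_digraph" where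
  "graph_complement G = \<lparr> pverts = pverts G,
     parcs = {(u, v). u \<in> pverts G \<and> v \<in> pverts G \<and> u \<noteq> v \<and> (u, v) \<notin> parcs G} \<rparr>"

definition leaves :: "'a pair_pre_digraph \<Rightarrow> 'a set" where
  "leaves G = {v \<in> pverts G. out_degree (with_proj G) v = 1}"

definition undirected_edges :: "'a pair_pre_digraph \<Rightarrow> 'a set set" where
  "undirected_edges G = {{u, v} | u v. (u, v) \<in> parcs G}"

fun middle_adj :: "'a + 'a set \<Rightarrow> 'a + 'a set \<Rightarrow> bool" where
  "middle_adj (Inl u) (Inl v) \<longleftrightarrow> False"
| "middle_adj (Inl v) (Inr e) \<longleftrightarrow> v \<in> e"
| "middle_adj (Inr e) (Inl v) \<longleftrightarrow> v \<in> e"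
| "middle_adj (Inr e) (Inr f) \<longleftrightarrow> e \<noteq> f \<and> e \<inter> f \<noteq> {}"

definition middle_graph :: "'a pair_pre_digraph \<Rightarrow> ('a + 'a set) pair_pre_digraph" where
  "middle_graph G = \<lparr> pverts = pverts G <+> undirected_edges G,
     parcs = {(x, y). x \<in> pverts G <+> undirected_edges G \<and>
                      y \<in> pverts G <+> undirected_edges G \<and> middle_adj x y} \<rparr>"

definition total_dominating_set :: "'a pair_pre_digraph \<Rightarrow> 'a set \<Rightarrow> bool" where
  "total_dominating_set H D \<longleftrightarrow>
     D \<subseteq> pverts H \<and> (\<forall>v \<in> pverts H. \<exists>u \<in> D. (v, u) \<in> parcs H)"

text \<open>The library's \<^const>\<open>connected\<close> requires a nonempty vertex set, so \<open>D\<close> is always a proper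
  subset of the vertices here.\<close>

definition total_outer_connected_dominating_set :: "'a pair_pre_digraph \<Rightarrow> 'a set \<Rightarrow> bool" where
  "total_outer_connected_dominating_set H D \<longleftrightarrow>
     total_dominating_set H D \<and> connected (with_proj H \<restriction> (pverts H - D))"

definition gamma_tc :: "'a pair_pre_digraph \<Rightarrow> nat" where
  "gamma_tc H = (LEAST k. \<exists>D. total_outer_connected_dominating_set H D \<and> card D = k)"

lemma pair_graph_graph_complement:
  assumes "pair_graph G"
  shows "pair_graph (graph_complement G)"
proof -
  interpret pair_graph G by fact
  have "finite (parcs (graph_complement G))"
    by (rule finite_subset[of _ "pverts G \<times> pverts G"])
      (auto simp: graph_complement_def pair_finite_verts)
  moreover have "(u, v) \<in> parcs G \<longleftrightarrow> (v, u) \<in> parcs G" for u v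
    using pair_sym_arcs by (auto simp: symmetric_def dest: symD)
  ultimately show ?thesis
    by unfold_locales
      (auto simp: graph_complement_def pair_finite_verts symmetric_def intro!: symI)
qed

lemma middle_adj_sym: "middle_adj x y \<Longrightarrow> middle_adj y x"
  by (cases x; cases y) auto

lemma middle_adj_irrefl: "\<not> middle_adj x x"
  by (cases x) auto

lemma pair_graph_middle_graph:
  assumes "pair_graph G"
  shows "pair_graph (middle_graph G)"
proof -
  interpret pair_graph G by fact
  have "undirected_edges G = (\<lambda>(u, v). {u, v}) ` parcs G"
    by (auto simp: undirected_edges_def)
  then have fin: "finite (pverts G <+> undirected_edges G)"
    by (simp add: pair_finite_verts pair_finite_arcs)
  moreover have "finite (parcs (middle_graph G))"
    by (rule finite_subset[OF _ finite_cartesian_product[OF fin fin]])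
      (auto simp: middle_graph_def)
  ultimately show ?thesis
    by unfold_locales
      (auto simp: middle_graph_def symmetric_def middle_adj_irrefl
        intro!: symI dest: middle_adj_sym)
qed

end

theory Submission
  imports Defs
begin

text \<open>Lower bound: the pendant edge at a leaf \<open>v\<close> is the only neighbour of \<open>v\<close> in the middle graph,
  so every total dominating set contains it. If moreover \<open>v\<close> lies outside \<open>D\<close>, then \<open>v\<close> is isolated
  outside \<open>D\<close>, hence the only element outside \<open>D\<close>.

  Upper bound: for an edge \<open>uv\<close> whose two ends have degree at least 2, all of \<open>M(G)\<close> except \<open>u\<close> and
  \<open>uv\<close> is a total outer-connected dominating set. Such an edge exists in \<open>T\<close> and in its complement,
  since a connected graph without one is a star, and its complement is then disconnected. Finally,
  the orders of the two middle graphs add up to \<open>2n + n(n-1)/2\<close>.\<close>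

section \<open>Connectivity through closed vertex sets, and basic facts on graphs\<close>

lemma connected_closed_set:
  assumes "connected G" "x \<in> S" "x \<in> verts G" "y \<in> verts G"
    and closed: "\<And>e. e \<in> arcs G \<Longrightarrow> tail G e \<in> S \<longleftrightarrow> head G e \<in> S"
  shows "y \<in> S"
proof -
  \<comment> \<open>\<open>connected\<close> means strong connectivity of the symmetric closure,
    whose arcs may run against those of \<open>G\<close>; this is why \<open>closed\<close> is an
    equivalence.\<close>
  have "x \<rightarrow>\<^sup>*\<^bsub>with_proj (mk_symmetric G)\<^esub> y"
    using assms by (auto simp: connected_def strongly_connected_def)
  then have "(x, y) \<in> rtrancl_on (verts G) (parcs (mk_symmetric G))"
    by (simp add: reachable_def)
  then show ?thesis
    by (induction rule: rtrancl_on_induct) (use assms in \<open>auto simp: parcs_mk_symmetric\<close>)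
qed

text \<open>In a symmetric digraph, closure along arcs in one direction implies closure in the
  other. The contrapositive yields an arc leaving any nonempty proper set of vertices.\<close>

lemma connected_with_proj_closed_set:
  assumes "pair_graph G" "connected (with_proj G)" "x \<in> S" "x \<in> pverts G" "y \<in> pverts G"
    and "\<And>u v. (u, v) \<in> parcs G \<Longrightarrow> u \<in> S \<Longrightarrow> v \<in> S"
  shows "y \<in> S"
proof -
  interpret pair_graph G by fact
  have "sym (parcs G)"
    using pair_sym_arcs by (simp add: symmetric_def)
  then show ?thesis
    using assms by (intro connected_closed_set[of "with_proj G" x S y]) (auto dest: symD)
qed

lemma pair_graph_arcs:
  assumes "pair_graph G" "(u, v) \<in> parcs G"
  shows "(v, u) \<in> parcs G" "u \<noteq> v" "u \<in> pverts G" "v \<in> pverts G"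
proof -
  interpret pair_graph G by fact
  show "(v, u) \<in> parcs G"
    using pair_sym_arcs assms(2) by (auto simp: symmetric_def dest: symD)
  show "u \<noteq> v" using pair_no_loops[OF assms(2)] by simp
  show "u \<in> pverts G" "v \<in> pverts G" using assms(2) in_arcsD1 in_arcsD2 by auto
qed

lemma finite_undirected_edges: "pair_graph G \<Longrightarrow> finite (undirected_edges G)"
proof -
  assume "pair_graph G"
  then interpret pair_graph G .
  have "undirected_edges G = (\<lambda>(u, v). {u, v}) ` parcs G"
    by (auto simp: undirected_edges_def)
  then show ?thesis by (simp add: pair_finite_arcs)
qed

lemma finite_pverts: "pair_graph G \<Longrightarrow> finite (pverts G)"
  by (simp add: pair_graph_def pair_digraph_def pair_fin_digraph_def pair_fin_digraph_axioms_def)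

lemma pverts_middle_graph [simp]: "pverts (middle_graph G) = pverts G <+> undirected_edges G"
  by (simp add: middle_graph_def)

lemma connected_ex_neighbour:
  assumes G: "pair_graph G" "connected (with_proj G)" "2 \<le> card (pverts G)" and u: "u \<in> pverts G"
  obtains w where "(u, w) \<in> parcs G"
proof -
  have "\<not> pverts G \<subseteq> {u}"
    using card_mono[of "{u}" "pverts G"] G(3) by auto
  then obtain y where "y \<in> pverts G" "y \<noteq> u" by auto
  then show ?thesis
    using connected_with_proj_closed_set[OF G(1,2), of u "{u}" y] u that by auto
qed

section \<open>Leaves and the lower bound\<close>

lemma leaf_unique_neighbour:
  assumes "v \<in> leaves G"
  obtains w where "\<And>z. (v, z) \<in> parcs G \<longleftrightarrow> z = w"
proof -
  have "card {e \<in> parcs G. fst e = v} = 1"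
    using assms by (simp add: leaves_def out_degree_def out_arcs_def)
  then obtain e where e: "{e \<in> parcs G. fst e = v} = {e}"
    by (rule card_1_singletonE)
  show ?thesis
  proof (rule that[of "snd e"])
    fix z
    have "(v, z) \<in> parcs G \<longleftrightarrow> (v, z) \<in> {e \<in> parcs G. fst e = v}" by simp
    also have "\<dots> \<longleftrightarrow> z = snd e"
      using e by (metis (mono_tags, lifting) fst_conv mem_Collect_eq prod.collapse singletonD
          singletonI snd_conv)
    finally show "(v, z) \<in> parcs G \<longleftrightarrow> z = snd e" .
  qed
qed

text \<open>Two adjacent leaves would form a component of their own, leaving no room for a third
  vertex.\<close>

lemma leaf_neighbour_not_leaf:
  assumes G: "pair_graph G" "connected (with_proj G)" "3 \<le> card (pverts G)"
    and vw: "v \<in> leaves G" "(v, w) \<in> parcs G"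
  shows "w \<notin> leaves G"
proof
  assume "w \<in> leaves G"
  have "\<not> pverts G \<subseteq> {v, w}"
    using card_mono[of "{v, w}" "pverts G"] card_insert_le_m1[of 2 "{w}" v] G(3) by auto
  then obtain y where y: "y \<in> pverts G" "y \<notin> {v, w}" by auto
  have "(w, v) \<in> parcs G" "v \<in> pverts G"
    using pair_graph_arcs[OF G(1) vw(2)] by auto
  moreover have "z = w" if "(v, z) \<in> parcs G" for z
    using leaf_unique_neighbour[OF vw(1)] vw(2) that by metis
  moreover have "z = v" if "(w, z) \<in> parcs G" for z
    using leaf_unique_neighbour[OF \<open>w \<in> leaves G\<close>] \<open>(w, v) \<in> parcs G\<close> that by metis
  ultimately have "y \<in> {v, w}"
    using y(1) connected_with_proj_closed_set[OF G(1,2), of v "{v, w}" y] by blast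
  with y(2) show False by simp
qed

text \<open>The factor 2 comes from counting \<open>D\<close> separately on the two summands of the
  sum type: each leaf contributes its pendant edge as an \<open>Inr\<close> element, and equally
  many vertices lie in \<open>D\<close> as \<open>Inl\<close> elements.\<close>

lemma leaves_le_card_total_outer_connected_dominating_set:
  assumes G: "pair_graph G" "connected (with_proj G)" "3 \<le> card (pverts G)"
    and D: "total_outer_connected_dominating_set (middle_graph G) D"
  shows "2 * card (leaves G) \<le> card D"
proof -
  let ?M = "middle_graph G" and ?L = "leaves G"
  obtain nb where nb: "\<And>v z. v \<in> ?L \<Longrightarrow> (v, z) \<in> parcs G \<longleftrightarrow> z = nb v"
    using leaf_unique_neighbour by metis
  have sub: "D \<subseteq> pverts ?M"
    using D by (simp add: total_outer_connected_dominating_set_def total_dominating_set_def)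
  have finD: "finite D"
    using sub finite_pverts[OF pair_graph_middle_graph[OF G(1)]] by (rule finite_subset)
  have finL: "finite ?L"
    using finite_pverts[OF G(1)] by (simp add: leaves_def)
  have Lsub: "?L \<subseteq> pverts G" by (auto simp: leaves_def)
  have pendant: "e = {v, nb v}" if v: "v \<in> ?L" "e \<in> undirected_edges G" "v \<in> e" for v e
  proof -
    obtain x y where "e = {x, y}" "(x, y) \<in> parcs G"
      using v(2) by (auto simp: undirected_edges_def)
    then show ?thesis
      using nb[OF v(1)] pair_graph_arcs(1)[OF G(1), of x y] v(3) by auto
  qed
  have only: "x = Inr {v, nb v}" if "v \<in> ?L" "(Inl v, x) \<in> parcs ?M" for v x
    using that pendant by (cases x) (auto simp: middle_graph_def)
  have in_D: "Inr {v, nb v} \<in> D" if "v \<in> ?L" for v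
    using D that only Lsub
    by (fastforce simp: total_outer_connected_dominating_set_def total_dominating_set_def)
  have nbL: "nb v \<notin> ?L" if "v \<in> ?L" for v
    using leaf_neighbour_not_leaf[OF G that] nb[OF that] by auto
  \<comment> \<open>Two distinct leaves share a pendant edge only if they are adjacent, which
    \<open>nbL\<close> excludes.\<close>
  have inj: "inj_on (\<lambda>v. {v, nb v}) ?L"
    using nbL by (auto simp: inj_on_def doubleton_eq_iff)
  \<comment> \<open>If some leaf is outside \<open>D\<close>, its neighbour, which is not a leaf, takes its place in the count.\<close>
  obtain A where A: "finite A" "card A = card ?L" "Inl ` A \<subseteq> D"
  proof (cases "Inl ` ?L \<subseteq> D")
    case True
    then show ?thesis using that[of ?L] finL by auto
  next
    case False
    then obtain v where v: "v \<in> ?L" "Inl v \<notin> D" by auto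
    have rest: "x = Inl v" if x: "x \<in> pverts ?M" "x \<notin> D" for x
    proof -
      have "x \<in> {Inl v}"
      proof (rule connected_closed_set[of _ "Inl v"])
        show "connected (with_proj ?M \<restriction> (pverts ?M - D))"
          using D by (simp add: total_outer_connected_dominating_set_def)
        fix e assume "e \<in> arcs (with_proj ?M \<restriction> (pverts ?M - D))"
        then have e: "e \<in> parcs ?M" "fst e \<notin> D" "snd e \<notin> D" by auto
        \<comment> \<open>\<open>only\<close> concerns arcs that start at \<open>Inl v\<close>; the
          reversed arc handles those that end there.\<close>
        have "(snd e, fst e) \<in> parcs ?M"
          using pair_graph_arcs(1)[OF pair_graph_middle_graph[OF G(1)], of "fst e" "snd e"] e(1)
          by simp
        then have "fst e \<noteq> Inl v" "snd e \<noteq> Inl v"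
          using only[OF v(1)] in_D[OF v(1)] e by (metis prod.collapse)+
        then show "tail (with_proj ?M \<restriction> (pverts ?M - D)) e \<in> {Inl v} \<longleftrightarrow>
            head (with_proj ?M \<restriction> (pverts ?M - D)) e \<in> {Inl v}"
          by simp
      qed (use x v Lsub in auto)
      then show ?thesis by simp
    qed
    have nv: "nb v \<in> pverts G"
      using nb[OF v(1)] pair_graph_arcs(4)[OF G(1)] by blast
    show ?thesis
    proof (rule that[of "insert (nb v) (?L - {v})"])
      show "card (insert (nb v) (?L - {v})) = card ?L"
        using v(1) finL nbL[OF v(1)] by (simp add: card_Suc_Diff1 del: card_Diff_insert)
      show "Inl ` insert (nb v) (?L - {v}) \<subseteq> D"
      proof
        fix x :: "'a + 'a set" assume "x \<in> Inl ` insert (nb v) (?L - {v})"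
        then have "x \<in> pverts ?M" "x \<noteq> Inl v"
          using nv Lsub nbL[OF v(1)] v(1) by auto
        then show "x \<in> D" using rest by blast
      qed
    qed (use finL in simp)
  qed
  have "card (A <+> (\<lambda>v. {v, nb v}) ` ?L) \<le> card D"
    using A(3) in_D by (intro card_mono finD) auto
  then show ?thesis
    using A finL inj by (simp add: card_Plus card_image)
qed

section \<open>Edges between non-leaves and the upper bound\<close>

lemma ex_edge_between_non_leaves:
  assumes G: "pair_graph G" "connected (with_proj G)" "3 \<le> card (pverts G)"
    and non_nb: "\<And>u. u \<in> pverts G \<Longrightarrow> \<exists>w \<in> pverts G. w \<noteq> u \<and> (u, w) \<notin> parcs G"
  obtains u v a b where "(u, v) \<in> parcs G" "(u, a) \<in> parcs G" "a \<noteq> v"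
    "(v, b) \<in> parcs G" "b \<noteq> u"
proof -
  note arcs = pair_graph_arcs[OF G(1)]
  obtain x where x: "x \<in> pverts G" using G(3) by fastforce
  obtain y where xy: "(x, y) \<in> parcs G"
    using connected_ex_neighbour[OF G(1,2) _ x] G(3) by auto
  have "\<not> pverts G \<subseteq> {x, y}"
    using card_mono[of "{x, y}" "pverts G"] card_insert_le_m1[of 2 "{y}" x] G(3) by auto
  then obtain z where "z \<in> pverts G" "z \<notin> {x, y}" by auto
  \<comment> \<open>An arc leaves the set \<open>{x, y}\<close>. Its start \<open>s\<close> has two
    neighbours, \<open>t\<close> and the other end of the edge \<open>xy\<close>, so
    \<open>s\<close> can serve as \<open>u\<close>.\<close>
  then obtain s t where "(s, t) \<in> parcs G" "s \<in> {x, y}" "t \<notin> {x, y}"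
    using connected_with_proj_closed_set[OF G(1,2), of x "{x, y}" z] x by blast
  then obtain u p q where u: "(u, p) \<in> parcs G" "(u, q) \<in> parcs G" "p \<noteq> q"
    using xy arcs(1)[OF xy] by auto
  obtain w where w: "w \<in> pverts G" "w \<noteq> u" "(u, w) \<notin> parcs G"
    using non_nb arcs(3)[OF u(1)] by blast
  \<comment> \<open>The closed neighbourhood of \<open>u\<close> misses \<open>w\<close>, so an arc
    \<open>(v, b)\<close> leaves it. As \<open>b\<close> is not a neighbour of \<open>u\<close>, the
    start \<open>v\<close> is not \<open>u\<close> itself but a neighbour of
    \<open>u\<close>.\<close>
  then obtain v b where v: "(v, b) \<in> parcs G" "v \<in> insert u {z. (u, z) \<in> parcs G}"
    "b \<notin> insert u {z. (u, z) \<in> parcs G}"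
    using connected_with_proj_closed_set[OF G(1,2), of u "insert u {z. (u, z) \<in> parcs G}" w]
      arcs(3)[OF u(1)] by blast
  then have "(u, v) \<in> parcs G" "b \<noteq> u" by auto
  \<comment> \<open>At least one of \<open>p\<close>, \<open>q\<close> differs from \<open>v\<close>
    and serves as \<open>a\<close>.\<close>
  with v(1) u that show ?thesis by metis
qed

text \<open>The witness omits only \<open>Inl u\<close> and \<open>Inr {u, v}\<close>. These two are
  adjacent, so what remains outside it is connected; \<open>a\<close> and \<open>b\<close> keep
  \<open>u\<close> and \<open>v\<close> dominated.\<close>

lemma ex_total_outer_connected_dominating_set_middle_graph:
  assumes G: "pair_graph G" "connected (with_proj G)" "2 \<le> card (pverts G)"
    and uv: "(u, v) \<in> parcs G" and ua: "(u, a) \<in> parcs G" "a \<noteq> v"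
    and vb: "(v, b) \<in> parcs G" "b \<noteq> u"
  obtains D where "total_outer_connected_dominating_set (middle_graph G) D"
    "card D + 2 = card (pverts G) + card (undirected_edges G)"
proof -
  let ?M = "middle_graph G" and ?S = "{Inl u, Inr {u, v}}"
  note arcs = pair_graph_arcs[OF G(1)]
  have edge: "{x, y} \<in> undirected_edges G" if "(x, y) \<in> parcs G" for x y
    using that by (auto simp: undirected_edges_def)
  have S: "?S \<subseteq> pverts ?M"
    using arcs(3)[OF uv] edge[OF uv] by auto
  have dom: "\<exists>y \<in> pverts ?M - ?S. (x, y) \<in> parcs ?M" if "x \<in> pverts ?M" for x
  proof (cases x)
    case (Inl w)
    \<comment> \<open>A vertex is dominated by an incident edge other than the omitted
      \<open>{u, v}\<close>: \<open>ua\<close> for \<open>u\<close>, \<open>vb\<close> for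
      \<open>v\<close>, and any incident edge otherwise.\<close>
    have "\<exists>z. (w, z) \<in> parcs G \<and> {w, z} \<noteq> {u, v}"
    proof -
      consider "w = u" | "w = v" | "w \<noteq> u" "w \<noteq> v" by auto
      then show ?thesis
      proof cases
        case 3
        with Inl that obtain z where "(w, z) \<in> parcs G"
          using connected_ex_neighbour[OF G, of w] by auto
        with 3 show ?thesis by (auto simp: doubleton_eq_iff)
      next
        case 1
        then show ?thesis
          using ua by (intro exI[of _ a]) (auto simp: doubleton_eq_iff)
      next
        case 2
        then show ?thesis
          using vb by (intro exI[of _ b]) (auto simp: doubleton_eq_iff)
      qed
    qed
    then obtain z where "(w, z) \<in> parcs G" "{w, z} \<noteq> {u, v}" by blast
    then show ?thesis
      using that edge Inl by (intro bexI[of _ "Inr {w, z}"]) (auto simp: middle_graph_def)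
  next
    case (Inr e)
    with that obtain w z where wz: "e = {w, z}" "(w, z) \<in> parcs G"
      by (auto simp: undirected_edges_def)
    \<comment> \<open>An edge is dominated by one of its ends; at least one end is not
      \<open>u\<close> and thus was not omitted.\<close>
    then obtain y where "y \<in> e" "y \<noteq> u" "y \<in> pverts G"
      using arcs(2-4)[OF wz(2)] by (cases "w = u") auto
    then show ?thesis
      using that Inr by (intro bexI[of _ "Inl y"]) (auto simp: middle_graph_def)
  qed
  have conn: "connected (with_proj ?M \<restriction> (pverts ?M - (pverts ?M - ?S)))"
  proof -
    let ?H = "with_proj ?M \<restriction> ?S"
    have "(Inl u, Inr {u, v}) \<in> parcs ?M"
      using S by (auto simp: middle_graph_def)
    then have arc: "(Inl u, Inr {u, v}) \<in> parcs (mk_symmetric ?H)"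
        "(Inr {u, v}, Inl u) \<in> parcs (mk_symmetric ?H)"
      by (force simp: parcs_mk_symmetric)+
    interpret M: pair_graph ?M
      by (rule pair_graph_middle_graph[OF G(1)])
    interpret H: wf_digraph ?H
      using S by (intro M.wellformed_induce_subgraph)
    interpret P: pair_wf_digraph "mk_symmetric ?H"
      by (rule H.wellformed_mk_symmetric)
    have "connected ?H"
      using arc P.adj_in_verts
      by (auto simp: connected_def strongly_connected_def intro!: P.adj_reachable_trans)
    moreover have "pverts ?M - (pverts ?M - ?S) = ?S"
      using S by blast
    ultimately show ?thesis by simp
  qed
  have "total_outer_connected_dominating_set ?M (pverts ?M - ?S)"
    using dom conn
    by (auto simp: total_outer_connected_dominating_set_def total_dominating_set_def)
  moreover have "card (pverts ?M - ?S) + 2 = card (pverts G) + card (undirected_edges G)"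
  proof -
    have "card (pverts ?M - ?S) + card ?S = card (pverts ?M)"
      using S finite_pverts[OF pair_graph_middle_graph[OF G(1)]]
      by (metis card_Diff_subset card_mono finite_subset le_add_diff_inverse2)
    then show ?thesis
      using finite_pverts[OF G(1)] finite_undirected_edges[OF G(1)] by (simp add: card_Plus)
  qed
  ultimately show ?thesis by (rule that)
qed

text \<open>The minimum in \<open>gamma_tc\<close> is attained once some total outer-connected
  dominating set exists. The set built for the upper bound shows this, so the lower bound rests on
  it as well.\<close>

lemma gamma_tc_middle_graph_bounds:
  assumes G: "pair_graph G" "connected (with_proj G)" "3 \<le> card (pverts G)"
    and non_nb: "\<And>u. u \<in> pverts G \<Longrightarrow> \<exists>w \<in> pverts G. w \<noteq> u \<and> (u, w) \<notin> parcs G"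
  shows "2 * card (leaves G) \<le> gamma_tc (middle_graph G)"
    and "gamma_tc (middle_graph G) + 2 \<le> card (pverts G) + card (undirected_edges G)"
proof -
  let ?P = "\<lambda>k. \<exists>D. total_outer_connected_dominating_set (middle_graph G) D \<and> card D = k"
  obtain u v a b where uv: "(u, v) \<in> parcs G" "(u, a) \<in> parcs G" "a \<noteq> v"
    "(v, b) \<in> parcs G" "b \<noteq> u"
    by (rule ex_edge_between_non_leaves[OF G non_nb])
  have "2 \<le> card (pverts G)" using G(3) by simp
  then obtain D where D: "total_outer_connected_dominating_set (middle_graph G) D"
    "card D + 2 = card (pverts G) + card (undirected_edges G)"
    by (rule ex_total_outer_connected_dominating_set_middle_graph[OF G(1,2) _ uv])
  then have ex: "?P (card D)" by blast
  show "gamma_tc (middle_graph G) + 2 \<le> card (pverts G) + card (undirected_edges G)"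
    using Least_le[of ?P, OF ex] D(2) by (simp add: gamma_tc_def)
  obtain D' where "total_outer_connected_dominating_set (middle_graph G) D'"
    "card D' = gamma_tc (middle_graph G)"
    using LeastI[of ?P, OF ex] by (auto simp: gamma_tc_def)
  then show "2 * card (leaves G) \<le> gamma_tc (middle_graph G)"
    using leaves_le_card_total_outer_connected_dominating_set[OF G] by metis
qed

section \<open>Edges of a graph and its complement, and the two bounds combined\<close>

lemma card_undirected_edges_graph_complement:
  assumes G: "pair_graph G"
  shows "card (undirected_edges G) + card (undirected_edges (graph_complement G))
    = card (pverts G) choose 2"
proof -
  let ?C = "graph_complement G"
  note arcs = pair_graph_arcs[OF G]
  \<comment> \<open>Each two-element set of vertices is an edge of exactly one of the two
    graphs.\<close>
  have "undirected_edges G \<union> undirected_edges ?C = {e. e \<subseteq> pverts G \<and> card e = 2}"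
  proof (intro equalityI subsetI)
    fix e assume "e \<in> undirected_edges G \<union> undirected_edges ?C"
    then show "e \<in> {e. e \<subseteq> pverts G \<and> card e = 2}"
      by (auto simp: undirected_edges_def graph_complement_def dest: arcs(2-4))
  next
    fix e assume "e \<in> {e. e \<subseteq> pverts G \<and> card e = 2}"
    then obtain u v where "e = {u, v}" "u \<noteq> v" "u \<in> pverts G" "v \<in> pverts G"
      by (auto simp: card_2_iff)
    then show "e \<in> undirected_edges G \<union> undirected_edges ?C"
      by (cases "(u, v) \<in> parcs G") (auto simp: undirected_edges_def graph_complement_def)
  qed
  moreover have "undirected_edges G \<inter> undirected_edges ?C = {}"
    using arcs(1) by (fastforce simp: undirected_edges_def graph_complement_def doubleton_eq_iff)
  ultimately show ?thesis
    using card_Un_disjoint[of "undirected_edges G" "undirected_edges ?C"]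
      finite_undirected_edges[OF G] finite_undirected_edges[OF pair_graph_graph_complement[OF G]]
      n_subsets[OF finite_pverts[OF G], of 2]
    by simp
qed

theorem theorem5p3:
  fixes T :: "'a pair_pre_digraph" and n :: nat
  assumes "graph_tree T"
    and "card (pverts T) = n"
    and "n \<ge> 4"
    and "connected (with_proj (graph_complement T))"
  shows "2 * card (leaves T) + 2 * card (leaves (graph_complement T))
           \<le> gamma_tc (middle_graph T) + gamma_tc (middle_graph (graph_complement T))
       \<and> real (gamma_tc (middle_graph T) + gamma_tc (middle_graph (graph_complement T)))
           \<le> (real n ^ 2 + 3 * real n - 8) / 2"
proof -
  let ?C = "graph_complement T"
  have T: "pair_graph T" "connected (with_proj T)" "3 \<le> card (pverts T)"
    using assms by (auto simp: graph_tree_def)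
  have pC: "pverts ?C = pverts T" by (simp add: graph_complement_def)
  have C: "pair_graph ?C" "connected (with_proj ?C)" "3 \<le> card (pverts ?C)"
    using T assms pair_graph_graph_complement by (auto simp: pC)
  \<comment> \<open>A vertex adjacent to all others in one graph is isolated in the other, so
    connectedness of each graph gives the required non-neighbours in its complement.\<close>
  have nT: "\<exists>w \<in> pverts T. w \<noteq> u \<and> (u, w) \<notin> parcs T" if u: "u \<in> pverts T" for u
  proof -
    have "2 \<le> card (pverts ?C)" "u \<in> pverts ?C" using C(3) u pC by auto
    then obtain w where "(u, w) \<in> parcs ?C" by (rule connected_ex_neighbour[OF C(1,2)])
    then show ?thesis by (auto simp: graph_complement_def)
  qed
  have nC: "\<exists>w \<in> pverts ?C. w \<noteq> u \<and> (u, w) \<notin> parcs ?C" if u: "u \<in> pverts ?C" for u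
  proof -
    have "2 \<le> card (pverts T)" "u \<in> pverts T" using T(3) u pC by auto
    then obtain w where w: "(u, w) \<in> parcs T" by (rule connected_ex_neighbour[OF T(1,2)])
    then have "w \<in> pverts ?C" "w \<noteq> u" "(u, w) \<notin> parcs ?C"
      using pair_graph_arcs[OF T(1) w] by (auto simp: graph_complement_def)
    then show ?thesis by blast
  qed
  note bT = gamma_tc_middle_graph_bounds[OF T nT] and bC = gamma_tc_middle_graph_bounds[OF C nC]
  \<comment> \<open>The 4 collects the two omitted elements of each middle graph. Over the reals,
    \<open>2n + n(n - 1)/2 - 4\<close> is the claimed bound.\<close>
  have "gamma_tc (middle_graph T) + gamma_tc (middle_graph ?C) + 4 \<le> 2 * n + (n choose 2)"
    using bT(2) bC(2) card_undirected_edges_graph_complement[OF T(1)] assms(2) by (simp add: pC)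
  then have "real (gamma_tc (middle_graph T) + gamma_tc (middle_graph ?C)) + 4
      \<le> 2 * real n + real (n choose 2)"
    by linarith
  also have "real (n choose 2) = real n * (real n - 1) / 2"
    by (simp add: binomial_gbinomial gbinomial_prod_rev numeral_2_eq_2)
  finally show ?thesis
    using bT(1) bC(1) by (simp add: power2_eq_square field_simps)
qed

end
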